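(* Let $(w_i)_{i\in\mathbb{N}}$ be a sequence of positive real weights, let $n\ge 2$, and let $\mathcal{T}_n^w$ be a weighted recursive tree of size $n$ with these weights. Let $\mathcal{D}_n^{w}$ denote the depth of node $n$ in $\mathcal{T}_n^w$, let $Z_n^w$ denote the set of ancestors of $n$, and let $A_{i,n}^w := \mathbf{1}(i \in Z_n^w)$. Then $$\mathcal{D}_n^w = 1 + \sum_{i=2}^{n-1} A_{i,n}^w,$$ and the $A_{i,n}^w$, $i=2,\dots,n-1$, are mutually independent Bernoulli random variables with $$\mathbb{P}( A_{i,n}^w = 1) = \frac{w_i}{\sum_{j=1}^{i}w_j}.$$ Consequently, $$\mathbb{E}[\mathcal{D}_n^w] = \sum_{i=1}^{n-1} \frac{w_i}{\sum_{j=1}^{i}w_j} \qquad\text{and}\qquad \mathrm{Var}(\mathcal{D}_n^w) = \sum_{i=2}^{n-1} \frac{w_i}{\sum_{j=1}^{i}w_j} \left(1 - \frac{w_i}{\sum_{j=1}^{i}w_j} \right).$$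
   Context: Weighted recursive tree (WRT): given positive weights $(w_i)_{i\in\mathbb{N}}$, the WRT $\mathcal{T}_n^w$ of size $n$ is the random rooted tree on nodes $1,\dots,n$ built as follows. Node $1$ is the root; for $j=2,\dots,n$ successively and independently of the previous steps, node $j$ is attached as a child to node $i\in\{1,\dots,j-1\}$ with probability $\frac{w_i}{w_1+\cdots+w_{j-1}}$. The depth of node $n$ is the length (number of edges) of the path from the root to $n$. The ancestors of $n$ are the nodes other than $n$ on the path from the root to $n$ (including the root). *)

theory Defs
  imports "HOL-Probability.Probability" "Graph_Theory.Pair_Digraph"
begin

text \<open>
  A rooted tree on the nodes \<open>1, \<dots>, n\<close> is represented as a simple digraph whose arcs are the pairs
  \<open>(parent, child)\<close>; the root is always node \<open>1\<close>. As all arcs point away from the root, a directed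
  path starting in the root is the same as a path of the underlying undirected tree.
\<close>

type_synonym rtree = "nat pair_pre_digraph"

definition attach_child :: "rtree \<Rightarrow> nat \<Rightarrow> nat \<Rightarrow> rtree" where
  "attach_child T i j = \<lparr> pverts = insert j (pverts T), parcs = insert (i, j) (parcs T) \<rparr>"

text \<open>
  The law of the node that node \<open>Suc m\<close> is attached to. It is meaningful for \<open>m \<ge> 1\<close> and weights
  that are positive at all indices \<open>\<ge> 1\<close>, see \<open>pmf_attach_law\<close>; the value \<open>w 0\<close> is never used.
\<close>

definition attach_law :: "(nat \<Rightarrow> real) \<Rightarrow> nat \<Rightarrow> nat pmf" where
  "attach_law w m = embed_pmf (\<lambda>i. if i \<in> {1..m} then w i / (\<Sum>k=1..m. w k) else 0)"

lemma pmf_attach_law: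
  assumes "\<And>i. i \<ge> 1 \<Longrightarrow> w i > 0" and "m \<ge> 1"
  shows "pmf (attach_law w m) i = (if i \<in> {1..m} then w i / (\<Sum>k=1..m. w k) else 0)"
  unfolding attach_law_def
proof (rule pmf_embed_pmf)
  have pos: "(\<Sum>k=1..m. w k) > 0"
    using assms by (intro sum_pos) auto
  show nonneg: "0 \<le> (if i \<in> {1..m} then w i / (\<Sum>k=1..m. w k) else 0)" for i
    using assms(1)[of i] pos by auto
  have "(\<integral>\<^sup>+ i. ennreal (if i \<in> {1..m} then w i / (\<Sum>k=1..m. w k) else 0) \<partial>count_space UNIV) =
        (\<Sum>i=1..m. ennreal (if i \<in> {1..m} then w i / (\<Sum>k=1..m. w k) else 0))"
    by (rule nn_integral_count_space') auto
  also have "\<dots> = ennreal (\<Sum>i=1..m. if i \<in> {1..m} then w i / (\<Sum>k=1..m. w k) else 0)"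
    by (intro sum_ennreal nonneg)
  also have "(\<Sum>i=1..m. if i \<in> {1..m} then w i / (\<Sum>k=1..m. w k) else 0) = 1"
    using pos by (simp flip: sum_divide_distrib)
  finally show "(\<integral>\<^sup>+ i. ennreal (if i \<in> {1..m} then w i / (\<Sum>k=1..m. w k) else 0)
      \<partial>count_space UNIV) = 1"
    by simp
qed

text \<open>
  The law of the weighted recursive tree of size \<open>n\<close>. In each step the parent of the new node is
  drawn independently of the tree built so far, as its law does not depend on that tree.
  The size \<open>0\<close> is a dummy case.
\<close>

fun wrt :: "(nat \<Rightarrow> real) \<Rightarrow> nat \<Rightarrow> rtree pmf" where
  "wrt w 0 = return_pmf \<lparr> pverts = {}, parcs = {} \<rparr>"
| "wrt w (Suc 0) = return_pmf \<lparr> pverts = {1}, parcs = {} \<rparr>"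
| "wrt w (Suc (Suc m)) =
     do {
       T \<leftarrow> wrt w (Suc m);
       i \<leftarrow> attach_law w (Suc m);
       return_pmf (attach_child T i (Suc (Suc m)))
     }"

text \<open>
  The path (as a list of arcs) from the root to \<open>v\<close>. It is well defined on the trees in the support
  of \<open>wrt w n\<close>, see \<open>ex1_root_path\<close>.
\<close>

definition root_path :: "rtree \<Rightarrow> nat \<Rightarrow> (nat \<times> nat) list" where
  "root_path T v = (THE p. pre_digraph.apath (with_proj T) 1 p v)"

definition depth :: "rtree \<Rightarrow> nat \<Rightarrow> nat" where
  "depth T v = length (root_path T v)"

definition ancestors :: "rtree \<Rightarrow> nat \<Rightarrow> nat set" where
  "ancestors T v = set (pre_digraph.awalk_verts (with_proj T) 1 (root_path T v)) - {v}"

text \<open>The indicator \<open>A\<^sub>i\<^sub>,\<^sub>n\<close> of the event that \<open>i\<close> is an ancestor of \<open>n\<close> in the tree \<open>T\<close>.\<close>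

definition anc_ind :: "nat \<Rightarrow> nat \<Rightarrow> rtree \<Rightarrow> real" where
  "anc_ind n i T = indicator (ancestors T n) i"

lemma wrt_support:
  assumes "\<And>i. i \<ge> 1 \<Longrightarrow> w i > 0" and "n \<ge> 1" and "T \<in> set_pmf (wrt w n)"
  shows "pverts T = {1..n} \<and> (\<forall>i j. (i, j) \<in> parcs T \<longrightarrow> 1 \<le> i \<and> i < j \<and> j \<le> n) \<and>
         (\<forall>j\<in>{2..n}. \<exists>!i. (i, j) \<in> parcs T)"
  using assms
proof (induction w n arbitrary: T rule: wrt.induct)
  case (3 w m)
  from "3.prems" obtain T' i where T': "T' \<in> set_pmf (wrt w (Suc m))"
    and i: "i \<in> set_pmf (attach_law w (Suc m))" and T: "T = attach_child T' i (Suc (Suc m))"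
    by auto
  have i': "1 \<le> i" "i \<le> Suc m"
    using i pmf_attach_law[of w "Suc m" i, OF "3.prems"(1)]
    by (simp_all add: set_pmf_iff split: if_splits)
  have IH: "pverts T' = {1..Suc m}"
      "\<And>i j. (i, j) \<in> parcs T' \<Longrightarrow> 1 \<le> i \<and> i < j \<and> j \<le> Suc m"
      "\<And>j. j \<in> {2..Suc m} \<Longrightarrow> \<exists>!i. (i, j) \<in> parcs T'"
    using "3.IH"[OF "3.prems"(1) _ T'] by simp_all
  have verts: "pverts T = {1..Suc (Suc m)}"
    by (auto simp: T attach_child_def IH(1))
  moreover have "1 \<le> a \<and> a < b \<and> b \<le> Suc (Suc m)" if "(a, b) \<in> parcs T" for a b
    using that i' IH(2)[of a b] by (auto simp: T attach_child_def)
  moreover have "\<exists>!a. (a, b) \<in> parcs T" if "b \<in> {2..Suc (Suc m)}" for b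
  proof (cases "b = Suc (Suc m)")
    case True
    thus ?thesis using IH(2) by (fastforce simp: T attach_child_def)
  next
    case False
    thus ?thesis using that IH(3)[of b] by (simp add: T attach_child_def)
  qed
  ultimately show ?case by blast
qed auto

lemma ex1_root_path:
  assumes "\<And>i. i \<ge> 1 \<Longrightarrow> w i > 0" and "T \<in> set_pmf (wrt w n)" and "v \<in> {1..n}"
  shows "\<exists>!p. pre_digraph.apath (with_proj T) 1 p v"
proof -
  have n: "n \<ge> 1" using assms(3) by auto
  note S = wrt_support[OF assms(1) n assms(2), simplified]
  have verts: "pverts T = {1..n}" using S by auto
  have arcs: "1 \<le> i \<and> i < j \<and> j \<le> n" if "(i, j) \<in> parcs T" for i j using S that by auto
  have ex1: "\<exists>!i. (i, j) \<in> parcs T" if "j \<in> {2..n}" for j using S that by auto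
  interpret wf_digraph "with_proj T"
    by unfold_locales (use arcs verts in fastforce)+
  have "\<exists>p. awalk 1 p v \<and> distinct (awalk_verts 1 p) \<and> set (awalk_verts 1 p) \<subseteq> {..v} \<and>
          (\<forall>q. awalk 1 q v \<longrightarrow> q = p)"
    using assms(3)
  proof (induction v rule: less_induct)
    case (less v)
    show ?case
    proof (cases "v = 1")
      case True
      have "q = []" if "awalk 1 q 1" for q
      proof (cases q rule: rev_cases)
        case (snoc q' e)
        with that have "e \<in> parcs T" "snd e = 1" by (auto simp: awalk_simps)
        with arcs[of "fst e" "snd e"] show ?thesis by (cases e) auto
      qed
      with True verts n show ?thesis
        by (intro exI[of _ "[]"]) (auto simp: awalk_simps)
    next
      case False
      with less.prems have "v \<in> {2..n}" by auto
      from ex1[OF this] obtain u where u: "(u, v) \<in> parcs T" "\<And>u'. (u', v) \<in> parcs T \<Longrightarrow> u' = u"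
        by blast
      have uv: "u < v" "u \<in> {1..n}" using arcs[OF u(1)] by auto
      from less.IH[OF this] obtain p where p: "awalk 1 p u" "distinct (awalk_verts 1 p)"
        "set (awalk_verts 1 p) \<subseteq> {..u}" "\<And>q. awalk 1 q u \<Longrightarrow> q = p" by blast
      have walk: "awalk 1 (p @ [(u, v)]) v"
        using p(1) u(1) less.prems verts by (auto simp: awalk_simps)
      have vs: "awalk_verts 1 (p @ [(u, v)]) = awalk_verts 1 p @ [v]"
        using walk p(1) by (auto simp: awalk_verts_append awalk_verts_conv)
      have "q = p @ [(u, v)]" if q: "awalk 1 q v" for q
      proof (cases q rule: rev_cases)
        case Nil
        with q False show ?thesis by (auto simp: awalk_simps)
      next
        case (snoc q' e)
        with q have "e \<in> parcs T" "snd e = v" "awalk 1 q' (fst e)" by (auto simp: awalk_simps)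
        with u(2)[of "fst e"] p(4) snoc show ?thesis by (cases e) auto
      qed
      moreover have "distinct (awalk_verts 1 (p @ [(u, v)]))"
        using p(2,3) uv(1) unfolding vs by auto
      moreover have "set (awalk_verts 1 (p @ [(u, v)])) \<subseteq> {..v}"
        using p(3) uv(1) unfolding vs by auto
      ultimately show ?thesis using walk by blast
    qed
  qed
  thus ?thesis unfolding apath_def by blast
qed

end

(*
  Call a node of the tree of size m weight-distributed if it is drawn with probabilities
  proportional to w 1, ..., w m, independently of the tree. The parent of node m + 1 is such a
  node. A weight-distributed node of the tree of size m + 1 is the new node m + 1 with probability
  p (m + 1) = w (m + 1) / (w 1 + ... + w (m + 1)), in which case its parent is weight-distributed
  among 1, ..., m; otherwise it is itself weight-distributed among 1, ..., m. In both cases the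
  rest of its path to the root has the law belonging to the tree of size m, so this path arises
  from {1} by including m, m - 1, ..., 2 according to independent Bernoulli(p i) coins.
*)

theory Submission
  imports Defs
begin

section \<open>Independence under image measures and the variance of independent sums\<close>

text \<open>Independence depends on the joint law only: it says that the joint law is the product of
  the marginals, and composing with \<open>f\<close> gives the same joint law and the same marginals
  as passing to the image measure.\<close>

lemma (in prob_space) indep_vars_distr_iff:
  assumes [measurable]: "f \<in> measurable M N" and [measurable]: "\<And>i. i \<in> I \<Longrightarrow> X i \<in> measurable N (M' i)"
  shows "prob_space.indep_vars (distr M N f) M' X I \<longleftrightarrow> indep_vars M' (\<lambda>i. X i \<circ> f) I"
proof -
  interpret N: prob_space "distr M N f"
    by (rule prob_space_distr) fact
  show ?thesis
  \<comment> \<open>The characterisation by product measures is for nonempty families; the empty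
    family is independent on both sides.\<close>
  proof (cases "I = {}")
    case True
    then show ?thesis
      by (simp add: indep_vars_def N.indep_vars_def indep_sets_def N.indep_sets_def)
  next
    case False
    have eq: "(\<lambda>x. \<lambda>i\<in>I. X i x) \<circ> f = (\<lambda>x. \<lambda>i\<in>I. (X i \<circ> f) x)"
      by auto
    have "distr (distr M N f) (PiM I M') (\<lambda>x. \<lambda>i\<in>I. X i x) =
        distr M (PiM I M') (\<lambda>x. \<lambda>i\<in>I. (X i \<circ> f) x)"
      by (subst distr_distr) (auto simp: eq intro!: measurable_restrict)
    moreover have "PiM I (\<lambda>i. distr (distr M N f) (M' i) (X i)) = PiM I (\<lambda>i. distr M (M' i) (X i \<circ> f))"
      by (intro PiM_cong) (auto simp: distr_distr)
    ultimately show ?thesis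
      using False
      by (subst indep_vars_iff_distr_eq_PiM', simp, force intro: measurable_comp assms)
         (subst N.indep_vars_iff_distr_eq_PiM', simp_all)
  qed
qed

text \<open>After centring, the square of the sum is expanded into a double sum. Independence makes
  the mixed products integrable with mean zero, so only the diagonal, integrable by
  \<open>int2\<close>, remains.\<close>

lemma (in prob_space) variance_sum_indep_vars:
  fixes X :: "'i \<Rightarrow> 'a \<Rightarrow> real"
  assumes I: "finite I" and ind: "indep_vars (\<lambda>_. borel) X I"
    and int: "\<And>i. i \<in> I \<Longrightarrow> integrable M (X i)"
    and int2: "\<And>i. i \<in> I \<Longrightarrow> integrable M (\<lambda>\<omega>. (X i \<omega>)\<^sup>2)"
  shows "variance (\<lambda>\<omega>. \<Sum>i\<in>I. X i \<omega>) = (\<Sum>i\<in>I. variance (X i))"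
proof -
  define Y where "Y = (\<lambda>i \<omega>. X i \<omega> - expectation (X i))"
  have Y_int: "integrable M (Y i)" and Y_0: "expectation (Y i) = 0"
    and Y_int2: "integrable M (\<lambda>\<omega>. Y i \<omega> * Y i \<omega>)" if "i \<in> I" for i
    using int[OF that] int2[OF that] by (simp_all add: Y_def prob_space algebra_simps power2_eq_square)
  have Y_ind: "indep_vars (\<lambda>_. borel) Y I"
    using indep_vars_compose2[OF ind, of "\<lambda>i x. x - expectation (X i)" "\<lambda>_. borel"]
    by (simp add: Y_def)
  have YY: "integrable M (\<lambda>\<omega>. Y i \<omega> * Y j \<omega>) \<and> expectation (\<lambda>\<omega>. Y i \<omega> * Y j \<omega>) = 0"
    if "i \<in> I" "j \<in> I" "i \<noteq> j" for i j
  proof -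
    have *: "indep_vars (\<lambda>_. borel) Y {i, j}"
      using that by (intro indep_vars_subset[OF Y_ind]) auto
    have "integrable M (\<lambda>\<omega>. \<Prod>k\<in>{i, j}. Y k \<omega>)"
      using that by (intro indep_vars_integrable[OF _ *]) (auto intro: Y_int)
    moreover have "expectation (\<lambda>\<omega>. \<Prod>k\<in>{i, j}. Y k \<omega>) = (\<Prod>k\<in>{i, j}. expectation (Y k))"
      using that by (intro indep_vars_lebesgue_integral[OF _ *]) (auto intro: Y_int)
    ultimately show ?thesis
      using that by (simp add: Y_0)
  qed
  have YY_int: "integrable M (\<lambda>\<omega>. Y i \<omega> * Y j \<omega>)" if "i \<in> I" "j \<in> I" for i j
    using YY[OF that] Y_int2 that by (cases "i = j") auto
  have "variance (\<lambda>\<omega>. \<Sum>i\<in>I. X i \<omega>) = expectation (\<lambda>\<omega>. \<Sum>i\<in>I. \<Sum>j\<in>I. Y i \<omega> * Y j \<omega>)"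
    by (simp add: Y_def int power2_eq_square sum_product flip: sum_subtractf)
  also have "\<dots> = (\<Sum>i\<in>I. \<Sum>j\<in>I. expectation (\<lambda>\<omega>. Y i \<omega> * Y j \<omega>))"
    by (simp add: YY_int)
  also have "\<dots> = (\<Sum>i\<in>I. \<Sum>j\<in>I. if j = i then variance (X i) else 0)"
    using YY by (intro sum.cong) (auto simp: Y_def power2_eq_square)
  also have "\<dots> = (\<Sum>i\<in>I. variance (X i))"
    using I by simp
  finally show ?thesis .
qed

section \<open>Vertex sets of root paths\<close>

text \<open>The endpoint \<open>v\<close> is kept, in contrast to \<open>ancestors\<close>: the line
  of a new node is then the line of its parent with one node added, which gives a clean
  recursion.\<close>

definition root_line :: "rtree \<Rightarrow> nat \<Rightarrow> nat set" where
  "root_line T v = set (pawalk_verts 1 (root_path T v))"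

lemma ancestors_eq: "ancestors T v = root_line T v - {v}"
  by (simp add: ancestors_def root_line_def awalk_verts_with_proj_eq)

text \<open>Separates the conditions that involve the tree, which are mere memberships, from those
  on the arc list alone. A path therefore visibly survives the growth of the tree.\<close>

lemma apath_with_proj_iff:
  "pre_digraph.apath (with_proj T) u p v \<longleftrightarrow>
    u \<in> pverts T \<and> set p \<subseteq> parcs T \<and> pcas u p v \<and> distinct (pawalk_verts u p)"
  by (simp add: pre_digraph.apath_def pre_digraph.awalk_def awalk_verts_with_proj_eq cas_with_proj_eq)

lemma pcas_snoc: "pcas u (p @ [e]) v \<longleftrightarrow> pcas u p (fst e) \<and> snd e = v"
  by (induction p arbitrary: u) auto

lemma pawalk_verts_snoc: "pcas u p (fst e) \<Longrightarrow> pawalk_verts u (p @ [e]) = pawalk_verts u p @ [snd e]"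
  by (induction p arbitrary: u) auto

lemma length_pawalk_verts: "length (pawalk_verts u p) = Suc (length p)"
  by (induction p arbitrary: u) auto

lemma last_in_pawalk_verts: "pcas u p v \<Longrightarrow> v \<in> set (pawalk_verts u p)"
  by (induction p arbitrary: u) auto

lemma pawalk_verts_subset:
  "pcas u p v \<Longrightarrow> set (pawalk_verts u p) \<subseteq> insert u (snd ` set p)"
  by (induction p arbitrary: u) auto

lemma wrt_Suc:
  assumes "m \<ge> 1"
  shows "wrt w (Suc m) = wrt w m \<bind> (\<lambda>T. map_pmf (\<lambda>j. attach_child T j (Suc m)) (attach_law w m))"
  using assms by (cases m) (simp_all add: map_pmf_def)

section \<open>Root paths in random trees and their behaviour when a node is attached\<close>

context
  fixes w :: "nat \<Rightarrow> real"
  assumes w_pos: "\<And>i. i \<ge> 1 \<Longrightarrow> w i > 0"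
begin

lemma root_path:
  assumes "T \<in> set_pmf (wrt w n)" "v \<in> {1..n}"
  shows "pre_digraph.apath (with_proj T) 1 (root_path T v) v"
  unfolding root_path_def by (rule theI'[OF ex1_root_path[OF w_pos assms]])

text \<open>By uniqueness, exhibiting any path from the root suffices to compute
  \<open>root_path\<close>.\<close>

lemma root_path_eqI:
  assumes "T \<in> set_pmf (wrt w n)" "v \<in> {1..n}" "pre_digraph.apath (with_proj T) 1 p v"
  shows "root_path T v = p"
  using ex1_root_path[OF w_pos assms(1,2)] root_path[OF assms(1,2)] assms(3) by blast

text \<open>A path with k arcs visits k + 1 distinct nodes, and removing the endpoint
  \<open>v\<close> leaves k.\<close>

lemma depth_eq_card_ancestors:
  assumes "T \<in> set_pmf (wrt w n)" "v \<in> {1..n}"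
  shows "depth T v = card (ancestors T v)"
proof -
  have "distinct (pawalk_verts 1 (root_path T v))" "pcas 1 (root_path T v) v"
    using root_path[OF assms] by (simp_all add: apath_with_proj_iff)
  then show ?thesis
    by (simp add: depth_def ancestors_eq root_line_def last_in_pawalk_verts distinct_card
        length_pawalk_verts)
qed

text \<open>Every node on the path is the root or the head of an arc of the tree. This is what makes
  a newly attached node fresh for all earlier root lines.\<close>

lemma root_line_subset:
  assumes "T \<in> set_pmf (wrt w n)" "v \<in> {1..n}"
  shows "root_line T v \<subseteq> {1..n}"
proof -
  have n: "n \<ge> 1"
    using assms(2) by simp
  have "snd ` set (root_path T v) \<subseteq> {1..n}"
    using wrt_support[OF w_pos n assms(1)] root_path[OF assms]
    by (fastforce simp: apath_with_proj_iff)
  moreover have "root_line T v \<subseteq> insert 1 (snd ` set (root_path T v))"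
    unfolding root_line_def
    using root_path[OF assms] by (intro pawalk_verts_subset[of _ _ v]) (simp add: apath_with_proj_iff)
  moreover have "1 \<in> {1..n}"
    using n by simp
  ultimately show ?thesis
    by blast
qed

lemma set_pmf_attach_law:
  assumes "m \<ge> 1" "i \<in> set_pmf (attach_law w m)"
  shows "i \<in> {1..m}"
  using assms by (auto simp: set_pmf_iff pmf_attach_law[OF w_pos] split: if_splits)

lemma attach_child_in_wrt:
  assumes "m \<ge> 1" "T \<in> set_pmf (wrt w m)" "i \<in> set_pmf (attach_law w m)"
  shows "attach_child T i (Suc m) \<in> set_pmf (wrt w (Suc m))"
  using assms by (cases m) auto

lemma root_path_attach_child_old:
  assumes "m \<ge> 1" "T \<in> set_pmf (wrt w m)" "i \<in> set_pmf (attach_law w m)" "v \<in> {1..m}"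
  shows "root_path (attach_child T i (Suc m)) v = root_path T v"
proof (rule root_path_eqI[OF attach_child_in_wrt[OF assms(1-3)]])
  show "pre_digraph.apath (with_proj (attach_child T i (Suc m))) 1 (root_path T v) v"
    using root_path[OF assms(2,4)] by (auto simp: apath_with_proj_iff attach_child_def)
qed (use assms in auto)

lemma root_path_attach_child_new:
  assumes "m \<ge> 1" "T \<in> set_pmf (wrt w m)" "i \<in> set_pmf (attach_law w m)"
  shows "root_path (attach_child T i (Suc m)) (Suc m) = root_path T i @ [(i, Suc m)]"
proof (rule root_path_eqI[OF attach_child_in_wrt[OF assms]])
  let ?p = "root_path T i"
  have p: "1 \<in> pverts T" "set ?p \<subseteq> parcs T" "pcas 1 ?p i" "distinct (pawalk_verts 1 ?p)"
    using root_path[OF assms(2) set_pmf_attach_law[OF assms(1,3)]] by (simp_all add: apath_with_proj_iff)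
  \<comment> \<open>All nodes on the path to \<open>i\<close> are at most \<open>m\<close>, so
    appending the new node keeps the path free of repetitions.\<close>
  have "Suc m \<notin> set (pawalk_verts 1 ?p)"
    using root_line_subset[OF assms(2) set_pmf_attach_law[OF assms(1,3)]] by (auto simp: root_line_def)
  then show "pre_digraph.apath (with_proj (attach_child T i (Suc m))) 1 (?p @ [(i, Suc m)]) (Suc m)"
    using p by (auto simp: apath_with_proj_iff attach_child_def pcas_snoc pawalk_verts_snoc)
qed auto

lemma root_line_attach_child_new:
  assumes "m \<ge> 1" "T \<in> set_pmf (wrt w m)" "i \<in> set_pmf (attach_law w m)"
  shows "root_line (attach_child T i (Suc m)) (Suc m) = insert (Suc m) (root_line T i)"
  using root_path[OF assms(2) set_pmf_attach_law[OF assms(1,3)]]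
  by (simp add: root_line_def root_path_attach_child_new[OF assms] apath_with_proj_iff pawalk_verts_snoc)

lemma root_line_attach_child_old:
  assumes "m \<ge> 1" "T \<in> set_pmf (wrt w m)" "i \<in> set_pmf (attach_law w m)" "v \<in> set_pmf (attach_law w m)"
  shows "root_line (attach_child T i (Suc m)) v = root_line T v"
  using root_path_attach_child_old[OF assms(1-3) set_pmf_attach_law[OF assms(1,4)]]
  by (simp add: root_line_def)

section \<open>Recursion for the root line of a weight-distributed node\<close>

lemma weight_ratio_bounds:
  assumes "i \<ge> 1"
  shows "0 \<le> w i / (\<Sum>j=1..i. w j)" "w i / (\<Sum>j=1..i. w j) \<le> 1"
proof -
  have "w i \<le> (\<Sum>j=1..i. w j)"
    using assms w_pos by (intro member_le_sum) (auto intro: less_imp_le)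
  moreover have "0 < w i"
    using assms by (rule w_pos)
  ultimately   show "0 \<le> w i / (\<Sum>j=1..i. w j)" "w i / (\<Sum>j=1..i. w j) \<le> 1"
    by (auto simp: divide_simps)
qed

text \<open>Conditioned on avoiding \<open>Suc m\<close>, the draw is again proportional to the
  weights: with s the sum of the first m weights, the coin shows \<open>False\<close> with
  probability s / (s + w (m + 1)), and multiplying this by w i / s gives w i / (s + w (m +
  1)).\<close>

lemma attach_law_Suc:
  assumes "m \<ge> 1"
  shows "attach_law w (Suc m) = do {
      b \<leftarrow> bernoulli_pmf (w (Suc m) / (\<Sum>j=1..Suc m. w j));
      if b then return_pmf (Suc m) else attach_law w m }"
proof (rule pmf_eqI)
  fix i
  define s where "s = (\<Sum>j=1..m. w j)"
  have "s > 0"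
    unfolding s_def using assms by (intro sum_pos w_pos) auto
  moreover have "w (Suc m) > 0" by (simp add: w_pos)
  moreover have "(\<Sum>j=1..Suc m. w j) = s + w (Suc m)" by (simp add: s_def)
  moreover have "(\<Sum>j=Suc 0..m. w j) = s" by (simp add: s_def)
  ultimately show "pmf (attach_law w (Suc m)) i = pmf (do {
      b \<leftarrow> bernoulli_pmf (w (Suc m) / (\<Sum>j=1..Suc m. w j));
      if b then return_pmf (Suc m) else attach_law w m }) i"
    using weight_ratio_bounds[of "Suc m"] assms
    by (cases "i = Suc m")
       (simp_all add: pmf_bind pmf_attach_law[OF w_pos] divide_simps)
qed

text \<open>\<open>Q m\<close> is the law of the root line of a node drawn by weight independently
  of the tree of size \<open>m\<close>. The parent of \<open>Suc m\<close> is itself such a node, so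
  both outcomes of the coin lead back to \<open>Q m\<close>.\<close>

lemma root_line_law_Suc:
  assumes "m \<ge> 1"
  defines "Q \<equiv> \<lambda>m. wrt w m \<bind> (\<lambda>T. map_pmf (root_line T) (attach_law w m))"
  shows "Q (Suc m) = do {
      b \<leftarrow> bernoulli_pmf (w (Suc m) / (\<Sum>j=1..Suc m. w j));
      map_pmf (\<lambda>S. if b then insert (Suc m) S else S) (Q m) }"
proof -
  let ?B = "bernoulli_pmf (w (Suc m) / (\<Sum>j=1..Suc m. w j))"
  \<comment> \<open>Here \<open>j\<close> is the parent of \<open>Suc m\<close> in the tree, while
    \<open>b\<close> and the last draw from \<open>attach_law w m\<close> determine the node whose
    line is observed.\<close>
  have "Q (Suc m) = do {
      T \<leftarrow> wrt w m;
      j \<leftarrow> attach_law w m;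
      b \<leftarrow> ?B;
      if b then return_pmf (root_line (attach_child T j (Suc m)) (Suc m))
      else map_pmf (root_line (attach_child T j (Suc m))) (attach_law w m) }"
    unfolding Q_def wrt_Suc[OF assms(1)] attach_law_Suc[OF assms(1)]
    by (simp add: bind_assoc_pmf bind_map_pmf map_bind_pmf if_distrib cong: if_cong)
  also have "\<dots> = do {
      T \<leftarrow> wrt w m;
      j \<leftarrow> attach_law w m;
      b \<leftarrow> ?B;
      if b then return_pmf (insert (Suc m) (root_line T j))
      else map_pmf (root_line T) (attach_law w m) }"
    by (intro bind_pmf_cong refl if_cong map_pmf_cong)
       (simp_all only: root_line_attach_child_new[OF assms(1)] root_line_attach_child_old[OF assms(1)])
  \<comment> \<open>The law of the coin depends neither on \<open>j\<close> nor on \<open>T\<close>,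
    so the toss can be moved to the front, past one draw at a time.\<close>
  also have "\<dots> = do {
      T \<leftarrow> wrt w m;
      b \<leftarrow> ?B;
      j \<leftarrow> attach_law w m;
      if b then return_pmf (insert (Suc m) (root_line T j))
      else map_pmf (root_line T) (attach_law w m) }"
    by (subst bind_commute_pmf) (rule refl)
  also have "\<dots> = do {
      b \<leftarrow> ?B;
      T \<leftarrow> wrt w m;
      j \<leftarrow> attach_law w m;
      if b then return_pmf (insert (Suc m) (root_line T j))
      else map_pmf (root_line T) (attach_law w m) }"
    by (rule bind_commute_pmf)
  also have "\<dots> = do {
      b \<leftarrow> ?B;
      map_pmf (\<lambda>S. if b then insert (Suc m) S else S) (Q m) }"
    unfolding Q_def
  proof (intro bind_pmf_cong refl)
    fix b
    show "wrt w m \<bind> (\<lambda>T. attach_law w m \<bind> (\<lambda>j.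
          if b then return_pmf (insert (Suc m) (root_line T j))
          else map_pmf (root_line T) (attach_law w m))) =
        map_pmf (\<lambda>S. if b then insert (Suc m) S else S)
          (wrt w m \<bind> (\<lambda>T. map_pmf (root_line T) (attach_law w m)))"
      \<comment> \<open>For \<open>True\<close> the line is that of the parent \<open>j\<close> plus
        the new node. For \<open>False\<close> the value \<open>j\<close> does not enter the result,
        so its draw integrates out.\<close>
      by (cases b) (simp_all add: map_bind_pmf map_pmf_def bind_assoc_pmf bind_return_pmf)
  qed
  finally show ?thesis .
qed

lemma root_line_law:
  assumes "m \<ge> 1"
  shows "wrt w m \<bind> (\<lambda>T. map_pmf (root_line T) (attach_law w m)) =
    map_pmf (\<lambda>f. insert 1 {i \<in> {2..m}. f i})
      (Pi_pmf {2..m} False (\<lambda>i. bernoulli_pmf (w i / (\<Sum>j=1..i. w j))))"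
  using assms
proof (induction m rule: nat_induct_at_least)
  case base
  let ?T = "\<lparr>pverts = {1}, parcs = {}\<rparr> :: rtree"
  \<comment> \<open>With a single node the draw is deterministic and \<open>{2..1}\<close> is empty,
    so both sides are the point mass at \<open>{1}\<close>.\<close>
  have "attach_law w 1 = return_pmf 1"
    using w_pos[of 1] by (intro pmf_eqI) (auto simp: pmf_attach_law[OF w_pos])
  moreover have "root_path ?T 1 = []"
    by (rule root_path_eqI[of _ 1]) (auto simp: apath_with_proj_iff)
  ultimately show ?case
    by (simp add: bind_return_pmf root_line_def)
next
  case (Suc m)
  \<comment> \<open>The product law splits off the coin of \<open>Suc m\<close>, matching the coin
    in the recursion.\<close>
  have "{2..Suc m} = insert (Suc m) {2..m}"
    using Suc.hyps by auto
  then show ?case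
    unfolding root_line_law_Suc[OF Suc.hyps] Suc.IH
    by (auto simp: Pi_pmf_insert' map_bind_pmf pmf.map_comp map_pmf_def[of _ "Pi_pmf _ _ _"] bind_assoc_pmf
      bind_return_pmf intro!: bind_pmf_cong arg_cong[where f = return_pmf] split: if_splits)
qed

text \<open>The parent of \<open>n\<close> is a weight-distributed node of the tree of size n - 1,
  and the ancestors of \<open>n\<close> form precisely the root line of that parent. Hence the coins
  run up to n - 1.\<close>

lemma ancestors_law:
  assumes "n \<ge> 2"
  shows "map_pmf (\<lambda>T. ancestors T n) (wrt w n) =
    map_pmf (\<lambda>f. insert 1 {i \<in> {2..n-1}. f i})
      (Pi_pmf {2..n-1} False (\<lambda>i. bernoulli_pmf (w i / (\<Sum>j=1..i. w j))))"
proof -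
  obtain m where m: "n = Suc m" "m \<ge> 1"
    using assms by (cases n) auto
  have notin: "Suc m \<notin> root_line T j"
    if "T \<in> set_pmf (wrt w m)" "j \<in> set_pmf (attach_law w m)" for T j
    using root_line_subset[OF that(1) set_pmf_attach_law[OF m(2) that(2)]] by auto
  have "map_pmf (\<lambda>T. ancestors T n) (wrt w n) = wrt w m \<bind> (\<lambda>T. map_pmf (root_line T) (attach_law w m))"
    unfolding m(1) wrt_Suc[OF m(2)] map_bind_pmf pmf.map_comp
    using m(2) by (intro bind_pmf_cong map_pmf_cong refl)
      (auto simp: ancestors_eq root_line_attach_child_new notin)
  then show ?thesis
    using root_line_law[OF m(2)] by (simp add: m(1))
qed

end

section \<open>Transfer from the coins to the given random tree, and moments of the depth\<close>

theorem theorem5p1: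
  fixes w :: "nat \<Rightarrow> real" and n :: nat
    and M :: "'a measure" and T :: "'a \<Rightarrow> rtree"
  assumes "\<And>i. i \<ge> 1 \<Longrightarrow> w i > 0"
    and "n \<ge> 2"
    and "prob_space M"
    and "T \<in> measurable M (count_space UNIV)"
    and "distr M (count_space UNIV) T = measure_pmf (wrt w n)"
  defines "D \<equiv> (\<lambda>\<omega>. real (depth (T \<omega>) n))"
    and "A \<equiv> (\<lambda>i \<omega>. anc_ind n i (T \<omega>))"
    and "p \<equiv> (\<lambda>i. w i / (\<Sum>j=1..i. w j))"
  shows "(AE \<omega> in M. D \<omega> = 1 + (\<Sum>i=2..n-1. A i \<omega>)) \<and>
    prob_space.indep_vars M (\<lambda>_. borel) A {2..n-1} \<and>
    (\<forall>i\<in>{2..n-1}.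
       distr M (count_space UNIV) (A i) = measure_pmf (map_pmf of_bool (bernoulli_pmf (p i))) \<and>
       measure M {\<omega> \<in> space M. A i \<omega> = 1} = p i) \<and>
    integrable M D \<and> integrable M (\<lambda>\<omega>. (D \<omega>)\<^sup>2) \<and>
    prob_space.expectation M D = (\<Sum>i=1..n-1. p i) \<and>
    prob_space.variance M D = (\<Sum>i=2..n-1. p i * (1 - p i))"
proof -
  interpret prob_space M by fact
  define I where "I = {2..n-1}"
  define P where "P = Pi_pmf I False (\<lambda>i. bernoulli_pmf (p i))"
  define F where "F = (\<lambda>f :: nat \<Rightarrow> bool. insert 1 {i \<in> I. f i})"
  define Anc where "Anc = (\<lambda>\<omega>. ancestors (T \<omega>) n)"
  note w_pos = assms(1) and T_meas [measurable] = assms(4) and T_distr = assms(5)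
  have Anc_meas [measurable]: "Anc \<in> M \<rightarrow>\<^sub>M count_space UNIV"
    unfolding Anc_def by (rule measurable_compose[OF T_meas]) simp
  have law: "map_pmf (\<lambda>T. ancestors T n) (wrt w n) = map_pmf F P"
    unfolding F_def P_def I_def p_def by (rule ancestors_law[OF w_pos assms(2)])
  \<comment> \<open>The bridge between \<open>M\<close> and the coin space \<open>P\<close>: every
    \<open>A i\<close> is a function of \<open>Anc\<close>, so joint and marginal laws can be
    computed from the coins.\<close>
  have Anc_distr: "distr M (count_space UNIV) Anc = distr P (count_space UNIV) F"
  proof -
    have "distr M (count_space UNIV) Anc =
        distr (distr M (count_space UNIV) T) (count_space UNIV) (\<lambda>T. ancestors T n)"
      by (simp add: distr_distr Anc_def o_def)
    then show ?thesis
      using law by (simp add: T_distr flip: map_pmf_rep_eq)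
  qed
  have A_eq: "A i = (\<lambda>S. indicator S i) \<circ> Anc" for i
    by (simp add: A_def Anc_def anc_ind_def o_def)
  \<comment> \<open>As 1 is not in \<open>I\<close>, the root inserted by \<open>F\<close> does not
    affect these indicators.\<close>
  have A_eq_F: "(\<lambda>S. indicator S i) \<circ> F = (\<lambda>f. of_bool (f i) :: real)" if "i \<in> I" for i
    using that by (auto simp: F_def I_def indicator_def)
  have p01: "0 \<le> p i" "p i \<le> 1" if "i \<in> I" for i
    using weight_ratio_bounds[of w i, OF w_pos] that by (auto simp: p_def I_def)

  have indep: "indep_vars (\<lambda>_. borel) A I"
  proof -
    \<comment> \<open>Independence of the coins is pushed forward along \<open>F\<close> to the
      common law of the ancestor set and then pulled back along \<open>Anc\<close> to
      \<open>M\<close>.\<close>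
    have "prob_space.indep_vars P (\<lambda>_. borel) (\<lambda>i f. of_bool (f i) :: real) I"
      unfolding P_def
      by (rule prob_space.indep_vars_compose2[OF _ indep_vars_Pi_pmf, where Y = "\<lambda>_. of_bool"])
         (auto simp: I_def measure_pmf.prob_space_axioms)
    then have "prob_space.indep_vars P (\<lambda>_. borel) (\<lambda>i. (\<lambda>S. indicator S i :: real) \<circ> F) I"
      by (subst prob_space.indep_vars_cong[OF measure_pmf.prob_space_axioms refl A_eq_F refl]) auto
    then have "prob_space.indep_vars (distr P (count_space UNIV) F) (\<lambda>_. borel)
        (\<lambda>i S. indicator S i :: real) I"
      by (subst prob_space.indep_vars_distr_iff[OF measure_pmf.prob_space_axioms]) auto
    then show ?thesis
      unfolding Anc_distr[symmetric] A_eq by (subst (asm) indep_vars_distr_iff) auto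
  qed

  have A_distr: "distr M (count_space UNIV) (A i) = measure_pmf (map_pmf of_bool (bernoulli_pmf (p i)))"
    if "i \<in> I" for i
  proof -
    have "distr M (count_space UNIV) (A i) =
        distr (distr M (count_space UNIV) Anc) (count_space UNIV) (\<lambda>S. indicator S i)"
      unfolding A_eq by (simp add: distr_distr)
    also have "\<dots> = distr P (count_space UNIV) (\<lambda>f. of_bool (f i))"
      by (simp add: Anc_distr distr_distr A_eq_F[OF that])
    also have "\<dots> = map_pmf of_bool (map_pmf (\<lambda>f. f i) P)"
      by (simp add: pmf.map_comp o_def map_pmf_rep_eq)
    also have "map_pmf (\<lambda>f. f i) P = bernoulli_pmf (p i)"
      using that by (simp add: P_def Pi_pmf_component I_def)
    finally show ?thesis .
  qed

  have A_meas [measurable]: "A i \<in> M \<rightarrow>\<^sub>M count_space UNIV" for i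
    unfolding A_eq by measurable
  have A_borel [measurable]: "A i \<in> borel_measurable M" for i
    unfolding A_eq by measurable
  have A_range: "A i \<omega> \<in> {0, 1}" for i \<omega>
    by (auto simp: A_def anc_ind_def indicator_def)
  have A_sq: "(A i \<omega>)\<^sup>2 = A i \<omega>" for i \<omega>
    using A_range[of i \<omega>] by auto
  have A_int: "integrable M (A i)" for i
  proof (rule integrable_const_bound[of _ 1])
    have "norm (A i \<omega>) \<le> 1" for \<omega>
      using A_range[of i \<omega>] by auto
    then show "AE \<omega> in M. norm (A i \<omega>) \<le> 1"
      by simp
  qed simp
  have A_prob: "prob {\<omega> \<in> space M. A i \<omega> = 1} = p i" if "i \<in> I" for i
  proof -
    have "prob {\<omega> \<in> space M. A i \<omega> = 1} = measure (distr M (count_space UNIV) (A i)) {1}"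
      by (subst measure_distr) (auto intro!: arg_cong[where f = prob])
    also have "\<dots> = measure (bernoulli_pmf (p i)) {True}"
      unfolding A_distr[OF that] measure_map_pmf by (auto intro!: arg_cong[where f = "measure _"])
    also have "\<dots> = p i"
      using p01[OF that] by (simp add: measure_pmf_single)
    finally show ?thesis .
  qed
  have A_exp: "expectation (A i) = p i" if "i \<in> I" for i
  proof -
    have "expectation (A i) = expectation (indicator {\<omega> \<in> space M. A i \<omega> = 1})"
      using A_range[of i] by (intro Bochner_Integration.integral_cong) (auto simp: indicator_def)
    then show ?thesis
      by (simp add: A_prob[OF that])
  qed
  have A_var: "variance (A i) = p i * (1 - p i)" if "i \<in> I" for i
    by (subst variance_eq) (simp_all add: A_sq A_int A_exp[OF that] right_diff_distrib power2_eq_square[of "p i"])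

  have D_eq: "AE \<omega> in M. D \<omega> = 1 + (\<Sum>i\<in>I. A i \<omega>)"
  proof -
    have "AE S in wrt w n. real (depth S n) = 1 + (\<Sum>i\<in>I. anc_ind n i S)"
    proof (rule AE_pmfI)
      fix S assume S: "S \<in> set_pmf (wrt w n)"
      \<comment> \<open>Equal laws have equal supports, so every tree in the support has an ancestor
        set of the form \<open>F f\<close>: the root together with a subset of
        \<open>I\<close>.\<close>
      have "ancestors S n \<in> set_pmf (map_pmf F P)"
        using S unfolding law[symmetric] by auto
      then obtain f where f: "ancestors S n = insert 1 {i \<in> I. f i}"
        by (auto simp: F_def)
      have "depth S n = card (ancestors S n)"
        using depth_eq_card_ancestors[OF w_pos S] assms(2) by simp
      also have "\<dots> = Suc (card {i \<in> I. f i})"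
        unfolding f by (subst card_insert_disjoint) (auto simp: I_def)
      also have "real \<dots> = 1 + (\<Sum>i\<in>I. of_bool (f i))"
        by (simp add: I_def Int_def)
      also have "\<dots> = 1 + (\<Sum>i\<in>I. anc_ind n i S)"
        unfolding anc_ind_def f by (auto simp: I_def indicator_def intro!: sum.cong)
      finally show "real (depth S n) = 1 + (\<Sum>i\<in>I. anc_ind n i S)" .
    qed
    then show ?thesis
      unfolding T_distr[symmetric] by (subst (asm) AE_distr_iff) (auto simp: D_def A_def)
  qed

  \<comment> \<open>The depth formula is available almost everywhere only; \<open>E\<close>
    satisfies it pointwise and is bounded, so integrability and moments of \<open>D\<close> are
    derived through \<open>E\<close>.\<close>
  define E where "E = (\<lambda>\<omega>. 1 + (\<Sum>i\<in>I. A i \<omega>))"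
  have D_meas [measurable]: "D \<in> borel_measurable M"
    unfolding D_def by (rule measurable_compose[OF T_meas]) simp
  have E_meas [measurable]: "E \<in> borel_measurable M"
    unfolding E_def by measurable
  have DE: "AE \<omega> in M. D \<omega> = E \<omega>"
    using D_eq by (simp add: E_def)
  have E_bound: "norm (E \<omega>) \<le> 1 + real (card I)" for \<omega>
  proof -
    have "0 \<le> A i \<omega>" "A i \<omega> \<le> 1" for i
      using A_range[of i \<omega>] by auto
    then have "0 \<le> (\<Sum>i\<in>I. A i \<omega>)" "(\<Sum>i\<in>I. A i \<omega>) \<le> (\<Sum>i\<in>I. 1)"
      by (intro sum_nonneg sum_mono; simp)+
    then show ?thesis by (simp add: E_def)
  qed
  have E_int: "integrable M E"
    using E_bound by (intro integrable_const_bound[of _ "1 + real (card I)"]) auto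
  have D_int: "integrable M D"
    using E_int DE by (subst integrable_cong_AE) auto
  have D_int2: "integrable M (\<lambda>\<omega>. (D \<omega>)\<^sup>2)"
  proof (rule integrable_const_bound[of _ "(1 + real (card I))\<^sup>2"])
    show "AE \<omega> in M. norm ((D \<omega>)\<^sup>2) \<le> (1 + real (card I))\<^sup>2"
      using DE by eventually_elim (unfold norm_power, intro power_mono, simp_all only: E_bound norm_ge_zero)
  qed simp
  have ED: "expectation D = expectation E"
    using DE by (intro integral_cong_AE) auto
  have E_exp: "expectation E = 1 + (\<Sum>i\<in>I. p i)"
    by (simp add: E_def A_int A_exp prob_space)
  \<comment> \<open>The constant 1 contributed by the root becomes the term i = 1, so the sum for
    the expectation starts at 1.\<close>
  have "p 1 = 1"
    using w_pos[of 1] by (simp add: p_def)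
  moreover have "{1..n-1} = insert 1 I"
    using assms(2) by (auto simp: I_def)
  ultimately have D_exp: "expectation D = (\<Sum>i=1..n-1. p i)"
    by (simp add: ED E_exp I_def)
  have "variance D = expectation (\<lambda>\<omega>. (E \<omega> - expectation E)\<^sup>2)"
    unfolding ED using DE by (intro integral_cong_AE) auto
  \<comment> \<open>The constant shift cancels, so the sum for the variance starts at 2.\<close>
  also have "\<dots> = variance (\<lambda>\<omega>. \<Sum>i\<in>I. A i \<omega>)"
    by (simp add: E_def A_int prob_space)
  also have "\<dots> = (\<Sum>i\<in>I. p i * (1 - p i))"
    using variance_sum_indep_vars[OF _ indep] by (simp add: I_def A_int A_sq A_var)
  finally have D_var: "variance D = (\<Sum>i\<in>I. p i * (1 - p i))" .
  show ?thesis
    using D_eq indep A_distr A_prob D_int D_int2 D_exp D_var unfolding I_def by blast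
qed

end
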